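(* Let $S$ be a finite nonempty set, $B$ the nonempty integral base-polyhedron defined by an integer-valued supermodular function $p$, $\dot B=B\cap\mathbb{Z}^S$, and $\hat p$ the linear extension of $p$. For an integer vector $c\in\mathbb{Z}^S$ with $c(s)\ge1$ for every $s\in S$, $$\min\Big\{\sum_{s\in S}c(s)x(s)^2 : x\in\dot B\Big\}=\max\Big\{\hat p(\pi)-\sum_{s\in S}\Big\lfloor\tfrac12\Big(\tfrac{\pi(s)}{c(s)}+1\Big)\Big\rfloor\Big(\pi(s)-c(s)\Big\lfloor\tfrac12\Big(\tfrac{\pi(s)}{c(s)}+1\Big)\Big\rfloor\Big) : \pi\in\mathbb{Z}^S\Big\}.$$
   Context: $p:2^S\to\mathbb{Z}\cup\{-\infty\}$ is supermodular ($p(X)+p(Y)\le p(X\cap Y)+p(X\cup Y)$ when the left terms are finite) with $p(\emptyset)=0$, $p(S)$ finite; $B=\{x\in\mathbb{R}^S:\widetilde x(S)=p(S),\ \widetilde x(Z)\ge p(Z)\ \forall Z\subset S\}$ where $\widetilde x(Z)=\sum_{v\in Z}x(v)$. The linear (Lovász) extension is $\hat p(\pi)=p(I_n)\pi(s_n)+\sum_{j=1}^{n-1}p(I_j)[\pi(s_j)-\pi(s_{j+1})]$ with $n=|S|$, $\pi(s_1)\ge\dots\ge\pi(s_n)$, $I_j=\{s_1,\dots,s_j\}$; it equals $\min\{\langle\pi,x\rangle:x\in\dot B\}$ (possibly $-\infty$). The maximum is understood as a supremum. *)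

theory Defs
  imports "HOL-Library.Extended_Real" "HOL-Library.FuncSet"
begin

text \<open>Vectors indexed by \<open>S\<close> are functions in \<open>S \<rightarrow>\<^sub>E UNIV\<close>, and set functions on \<open>S\<close> are
  functions on \<open>'a set\<close> of which only the values at subsets of \<open>S\<close> are used.\<close>

definition integer_valued :: "'a set \<Rightarrow> ('a set \<Rightarrow> ereal) \<Rightarrow> bool" where
  "integer_valued S p \<longleftrightarrow> (\<forall>X\<subseteq>S. p X = -\<infinity> \<or> (\<exists>k::int. p X = ereal (of_int k)))"

definition supermodular :: "'a set \<Rightarrow> ('a set \<Rightarrow> ereal) \<Rightarrow> bool" where
  "supermodular S p \<longleftrightarrow>
     (\<forall>X\<subseteq>S. \<forall>Y\<subseteq>S. \<bar>p X\<bar> \<noteq> \<infinity> \<longrightarrow> \<bar>p Y\<bar> \<noteq> \<infinity> \<longrightarrow> p X + p Y \<le> p (X \<inter> Y) + p (X \<union> Y))"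

definition base_polyhedron :: "'a set \<Rightarrow> ('a set \<Rightarrow> ereal) \<Rightarrow> ('a \<Rightarrow> real) set" where
  "base_polyhedron S p =
     {x \<in> S \<rightarrow>\<^sub>E UNIV. ereal (\<Sum>v\<in>S. x v) = p S \<and> (\<forall>Z. Z \<subset> S \<longrightarrow> ereal (\<Sum>v\<in>Z. x v) \<ge> p Z)}"

definition integral_points :: "'a set \<Rightarrow> ('a \<Rightarrow> real) set \<Rightarrow> ('a \<Rightarrow> real) set" where
  "integral_points S B = {x \<in> B. \<forall>v\<in>S. x v \<in> \<int>}"

definition decreasing_enumeration :: "'a set \<Rightarrow> ('a \<Rightarrow> real) \<Rightarrow> (nat \<Rightarrow> 'a) \<Rightarrow> bool" where
  "decreasing_enumeration S \<pi> s \<longleftrightarrow>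
     bij_betw s {1..card S} S \<and> (\<forall>i\<in>{1..card S}. \<forall>j\<in>{1..card S}. i \<le> j \<longrightarrow> \<pi> (s i) \<ge> \<pi> (s j))"

text \<open>A term with \<open>\<pi> (s j) = \<pi> (s (j + 1))\<close> vanishes even if \<open>p\<close> is \<open>-\<infinity>\<close> at the corresponding
  initial segment, since \<open>0 * -\<infinity> = 0\<close> in \<^typ>\<open>ereal\<close>.\<close>

definition lovasz_sum :: "'a set \<Rightarrow> ('a set \<Rightarrow> ereal) \<Rightarrow> ('a \<Rightarrow> real) \<Rightarrow> (nat \<Rightarrow> 'a) \<Rightarrow> ereal" where
  "lovasz_sum S p \<pi> s =
     p (s ` {1..card S}) * ereal (\<pi> (s (card S)))
     + (\<Sum>j = 1..<card S. p (s ` {1..j}) * ereal (\<pi> (s j) - \<pi> (s (j + 1))))"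

text \<open>The choice of the enumeration is immaterial: see \<open>linear_extension_eq\<close> below.\<close>

definition linear_extension :: "'a set \<Rightarrow> ('a set \<Rightarrow> ereal) \<Rightarrow> ('a \<Rightarrow> real) \<Rightarrow> ereal" where
  "linear_extension S p \<pi> = lovasz_sum S p \<pi> (SOME s. decreasing_enumeration S \<pi> s)"

lemma decreasing_enumerationD:
  assumes "decreasing_enumeration S \<pi> s"
  shows "inj_on s {1..card S}" and "s ` {1..card S} = S"
    and "\<And>i j. 1 \<le> i \<Longrightarrow> i \<le> j \<Longrightarrow> j \<le> card S \<Longrightarrow> \<pi> (s j) \<le> \<pi> (s i)"
    and "\<And>i. 1 \<le> i \<Longrightarrow> i \<le> card S \<Longrightarrow> s i \<in> S"
    and "\<And>v. v \<in> S \<Longrightarrow> \<exists>k. 1 \<le> k \<and> k \<le> card S \<and> v = s k"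
proof -
  show 1: "inj_on s {1..card S}" and 2: "s ` {1..card S} = S"
    using assms by (simp_all only: decreasing_enumeration_def bij_betw_def)
  show "\<pi> (s j) \<le> \<pi> (s i)" if "1 \<le> i" "i \<le> j" "j \<le> card S" for i j
    using assms that by (simp add: decreasing_enumeration_def)
  show "s i \<in> S" if "1 \<le> i" "i \<le> card S" for i
  proof -
    have "s i \<in> s ` {1..card S}" using that by simp
    then show ?thesis by (simp only: 2)
  qed
  show "\<exists>k. 1 \<le> k \<and> k \<le> card S \<and> v = s k" if "v \<in> S" for v
  proof -
    have "v \<in> s ` {1..card S}" using that by (simp only: 2)
    then show ?thesis by auto
  qed
qed

lemma decreasing_enumeration_exists:
  assumes "finite S"
  shows "\<exists>s. decreasing_enumeration S \<pi> s"
proof -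
  obtain ys where ys: "set ys = S" "distinct ys"
    using finite_distinct_list[OF assms] by blast
  define xs where "xs = sort_key (\<lambda>v. - \<pi> v) ys"
  have xs: "set xs = S" "distinct xs" "length xs = card S"
    using ys distinct_card[OF ys(2)] by (simp_all add: xs_def)
  have srt: "sorted (map (\<lambda>v. - \<pi> v) xs)"
    by (simp add: xs_def)
  have "bij_betw (\<lambda>i. i - 1) {1..card S} {..<card S}"
    by (rule bij_betw_byWitness[where f' = "\<lambda>i. i + 1"]) auto
  moreover have "bij_betw ((!) xs) {..<card S} S"
    by (rule bij_betw_nth) (simp_all only: xs)
  ultimately have "bij_betw (\<lambda>i. xs ! (i - 1)) {1..card S} S"
    using bij_betw_trans[of "\<lambda>i. i - 1" "{1..card S}" "{..<card S}" "(!) xs" S]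
    by (simp add: comp_def)
  moreover have "\<pi> (xs ! (i - 1)) \<ge> \<pi> (xs ! (j - 1))"
    if "i \<in> {1..card S}" "j \<in> {1..card S}" "i \<le> j" for i j
  proof -
    have "i - 1 \<le> j - 1" "i - 1 < length xs" "j - 1 < length xs"
      using that xs(3) by auto
    then show ?thesis
      using sorted_nth_mono[OF srt, of "i - 1" "j - 1"] by simp
  qed
  ultimately show ?thesis
    unfolding decreasing_enumeration_def by blast
qed

lemma decreasing_enumeration_le:
  assumes S: "finite S"
    and s: "decreasing_enumeration S \<pi> s" and t: "decreasing_enumeration S \<pi> t"
    and j: "j \<in> {1..card S}"
  shows "\<pi> (s j) \<le> \<pi> (t j)"
proof (rule ccontr)
  assume less: "\<not> \<pi> (s j) \<le> \<pi> (t j)"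
  have "s ` {1..j} \<subseteq> t ` {1..<j}"
  proof
    fix v assume "v \<in> s ` {1..j}"
    then obtain i where i: "i \<in> {1..j}" "v = s i" by blast
    with j have v: "v \<in> S" "\<pi> v \<ge> \<pi> (s j)"
      using decreasing_enumerationD(3,4)[OF s] by simp_all
    from decreasing_enumerationD(5)[OF t v(1)] obtain k where k: "k \<in> {1..card S}" "v = t k"
      by auto
    have "k < j"
    proof (rule ccontr)
      assume "\<not> k < j"
      then have "\<pi> (t k) \<le> \<pi> (t j)"
        using decreasing_enumerationD(3)[OF t, of j k] j k by simp
      moreover have "\<pi> (t k) \<ge> \<pi> (s j)"
        using v k by simp
      ultimately show False
        using less by linarith
    qed
    with k show "v \<in> t ` {1..<j}" by auto
  qed
  then have "card (s ` {1..j}) \<le> card (t ` {1..<j})"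
    by (intro card_mono) auto
  also have "\<dots> \<le> j - 1"
    using card_image_le[of "{1..<j}" t] by simp
  finally have "card (s ` {1..j}) \<le> j - 1" .
  moreover have "inj_on s {1..j}"
    using inj_on_subset[OF decreasing_enumerationD(1)[OF s], of "{1..j}"] j by simp
  ultimately show False
    using j by (auto simp: card_image)
qed

lemma decreasing_enumeration_segment:
  assumes s: "decreasing_enumeration S \<pi> s"
    and j: "j \<in> {1..<card S}" and drop: "\<pi> (s (j + 1)) < \<pi> (s j)"
  shows "s ` {1..j} = {v \<in> S. \<pi> v \<ge> \<pi> (s j)}"
proof
  show "s ` {1..j} \<subseteq> {v \<in> S. \<pi> v \<ge> \<pi> (s j)}"
    using decreasing_enumerationD(3,4)[OF s] j by (intro image_subsetI) simp
  show "{v \<in> S. \<pi> v \<ge> \<pi> (s j)} \<subseteq> s ` {1..j}"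
  proof
    fix v assume v: "v \<in> {v \<in> S. \<pi> v \<ge> \<pi> (s j)}"
    then have "v \<in> S" by simp
    from decreasing_enumerationD(5)[OF s this] obtain k where k: "k \<in> {1..card S}" "v = s k"
      by auto
    have "k \<le> j"
    proof (rule ccontr)
      assume "\<not> k \<le> j"
      then have "\<pi> (s k) \<le> \<pi> (s (j + 1))"
        using decreasing_enumerationD(3)[OF s, of "j + 1" k] j k by simp
      moreover have "\<pi> (s k) \<ge> \<pi> (s j)"
        using v k by simp
      ultimately show False
        using drop by linarith
    qed
    with k show "v \<in> s ` {1..j}" by auto
  qed
qed

lemma linear_extension_eq:
  assumes S: "finite S" "S \<noteq> {}" and s: "decreasing_enumeration S \<pi> s"
  shows "linear_extension S p \<pi> = lovasz_sum S p \<pi> s"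
proof -
  define t where "t = (SOME t. decreasing_enumeration S \<pi> t)"
  have t: "decreasing_enumeration S \<pi> t"
    unfolding t_def using someI_ex[OF decreasing_enumeration_exists[OF S(1)]] .
  have eq: "\<pi> (t j) = \<pi> (s j)" if "j \<in> {1..card S}" for j
    using decreasing_enumeration_le[OF S(1) s t that] decreasing_enumeration_le[OF S(1) t s that]
    by simp
  have pos: "card S \<in> {1..card S}"
    using S by (simp add: Suc_le_eq card_gt_0_iff)
  have "p (t ` {1..j}) * ereal (\<pi> (t j) - \<pi> (t (j + 1)))
      = p (s ` {1..j}) * ereal (\<pi> (s j) - \<pi> (s (j + 1)))" if j: "j \<in> {1..<card S}" for j
  proof -
    have e: "\<pi> (t j) = \<pi> (s j)" "\<pi> (t (j + 1)) = \<pi> (s (j + 1))"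
      using eq[of j] eq[of "j + 1"] j by auto
    have "\<pi> (s (j + 1)) \<le> \<pi> (s j)"
      using decreasing_enumerationD(3)[OF s, of j "j + 1"] j by simp
    then consider "\<pi> (s (j + 1)) = \<pi> (s j)" | "\<pi> (s (j + 1)) < \<pi> (s j)" by linarith
    then show ?thesis
    proof cases
      case 1
      with e show ?thesis by (simp flip: zero_ereal_def)
    next
      case 2
      with e decreasing_enumeration_segment[OF s j] decreasing_enumeration_segment[OF t j]
      show ?thesis by simp
    qed
  qed
  then have "(\<Sum>j = 1..<card S. p (t ` {1..j}) * ereal (\<pi> (t j) - \<pi> (t (j + 1))))
      = (\<Sum>j = 1..<card S. p (s ` {1..j}) * ereal (\<pi> (s j) - \<pi> (s (j + 1))))"
    by (intro sum.cong) auto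
  moreover have "t ` {1..card S} = s ` {1..card S}"
    using decreasing_enumerationD(2)[OF s] decreasing_enumerationD(2)[OF t] by simp
  ultimately show ?thesis
    using eq[OF pos] by (simp add: linear_extension_def lovasz_sum_def flip: t_def)
qed

end

theory Submission imports Defs begin

text \<open>Weak duality holds term by term: Abel summation compares the linear extension with
  \<open>\<langle>\<pi>, x\<rangle>\<close>, and \<open>k = \<lfloor>(\<pi>/c + 1)/2\<rfloor>\<close> maximizes \<open>k (\<pi> - c k)\<close> over the integers. For strong
  duality, let \<open>x\<close> be a minimizer, let \<open>T t\<close> be the smallest \<open>x\<close>-tight set containing \<open>t\<close>, and
  let \<open>\<pi> s\<close> be the maximum of \<open>c t (2 x t - 1)\<close> over all \<open>t\<close> with \<open>s \<in> T t\<close>. The upper level sets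
  of \<open>\<pi>\<close> are unions of sets \<open>T t\<close>, hence tight, which makes the linear extension equal to
  \<open>\<langle>\<pi>, x\<rangle>\<close>. If \<open>s \<in> T t\<close> then a unit can be moved from \<open>t\<close> to \<open>s\<close>, so minimality of \<open>x\<close> yields
  \<open>c s (2 x s - 1) \<le> \<pi> s \<le> c s (2 x s + 1)\<close>, which says that \<open>x s\<close> maximizes
  \<open>k (\<pi> s - c s k)\<close>.\<close>

section \<open>One-variable integer quadratics, and two summation identities\<close>

lemma discrete_concave_quadratic_max:
  fixes x y a c :: int
  assumes "c \<ge> 0" and "c * (2 * x - 1) \<le> a" and "a \<le> c * (2 * x + 1)"
  shows "y * (a - c * y) \<le> x * (a - c * x)"
proof -
  \<comment> \<open>This product is the difference of the two values. Distinct integers differ by at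
    least 1, so \<open>x + y\<close> is at least \<open>2 * x + 1\<close> or at most
    \<open>2 * x - 1\<close>, and the hypotheses give the second factor the sign of the
    first.\<close>
  have "0 \<le> (x - y) * (a - c * (x + y))"
  proof (cases x y rule: linorder_cases)
    case less
    then have "c * (2 * x + 1) \<le> c * (x + y)" using assms(1) by (intro mult_left_mono) auto
    with assms less show ?thesis by (intro mult_nonpos_nonpos) auto
  next
    case greater
    then have "c * (x + y) \<le> c * (2 * x - 1)" using assms(1) by (intro mult_left_mono) auto
    with assms greater show ?thesis by (intro mult_nonneg_nonneg) auto
  qed simp
  then show ?thesis by (simp add: algebra_simps)
qed

text \<open>These are the hypotheses of \<open>discrete_concave_quadratic_max\<close> at
  \<open>x = k\<close>, so the floor in the theorem is an integer maximizer.\<close>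

lemma half_floor_bounds:
  fixes a c :: int
  assumes "c \<ge> 1"
  defines "k \<equiv> \<lfloor>(1/2) * (real_of_int a / real_of_int c + 1)\<rfloor>"
  shows "c * (2 * k - 1) \<le> a" and "a \<le> c * (2 * k + 1)"
proof -
  have c: "real_of_int c > 0" using assms by simp
  have "real_of_int k \<le> (1/2) * (real_of_int a / real_of_int c + 1)"
    and "(1/2) * (real_of_int a / real_of_int c + 1) < real_of_int k + 1"
    unfolding k_def by linarith+
  then have "2 * real_of_int k - 1 \<le> real_of_int a / real_of_int c"
    and "real_of_int a / real_of_int c \<le> 2 * real_of_int k + 1"
    by argo+
  then have "real_of_int (c * (2 * k - 1)) \<le> real_of_int a"
    and "real_of_int a \<le> real_of_int (c * (2 * k + 1))"
    using c by (simp_all add: field_simps)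
  then show "c * (2 * k - 1) \<le> a" and "a \<le> c * (2 * k + 1)"
    by (simp_all only: of_int_le_iff)
qed

lemma abel_summation:
  fixes f g :: "nat \<Rightarrow> real"
  assumes "n \<ge> 1"
  shows "(\<Sum>i=1..n. f i * g i)
    = (\<Sum>i=1..n. g i) * f n + (\<Sum>j=1..<n. (\<Sum>i=1..j. g i) * (f j - f (j + 1)))"
  using assms by (induction n rule: dec_induct) (simp_all add: algebra_simps)

lemma sum_transfer:
  fixes x :: "'a \<Rightarrow> real"
  assumes "finite Z" "u \<noteq> d"
  shows "(\<Sum>v\<in>Z. (x(u := x u + a, d := x d - a)) v)
    = (\<Sum>v\<in>Z. x v) + (if u \<in> Z then a else 0) - (if d \<in> Z then a else 0)"
proof -
  have "(\<Sum>v\<in>Z. (x(u := x u + a, d := x d - a)) v)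
      = (\<Sum>v\<in>Z. x v + (if v = u then a else 0) - (if v = d then a else 0))"
    using assms(2) by (intro sum.cong) auto
  then show ?thesis
    using assms(1) by (simp add: sum.distrib sum_subtractf)
qed

section \<open>Tight sets and transfers between coordinates\<close>

locale integral_supermodular =
  fixes S :: "'a set" and p :: "'a set \<Rightarrow> ereal"
  assumes finite_ground: "finite S"
    and integer_valued: "integer_valued S p"
    and supermodular: "supermodular S p"
    and empty: "p {} = 0"
begin

abbreviation "B \<equiv> base_polyhedron S p"

definition tight :: "('a \<Rightarrow> real) \<Rightarrow> 'a set \<Rightarrow> bool" where
  "tight x Z \<longleftrightarrow> Z \<subseteq> S \<and> ereal (\<Sum>v\<in>Z. x v) = p Z"

text \<open>For \<open>t\<close> outside \<open>S\<close> the family is empty and the intersection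
  is \<open>UNIV\<close>.\<close>

definition tight_hull :: "('a \<Rightarrow> real) \<Rightarrow> 'a \<Rightarrow> 'a set" where
  "tight_hull x t = \<Inter>{Z. tight x Z \<and> t \<in> Z}"

lemma finite_sub: "Z \<subseteq> S \<Longrightarrow> finite Z"
  using finite_ground finite_subset by blast

lemma base_ge: "x \<in> B \<Longrightarrow> Z \<subseteq> S \<Longrightarrow> p Z \<le> ereal (\<Sum>v\<in>Z. x v)"
  unfolding base_polyhedron_def by (cases "Z = S") auto

lemma tight_ground: "x \<in> B \<Longrightarrow> tight x S"
  unfolding base_polyhedron_def tight_def by auto

lemma tight_empty: "tight x {}"
  by (simp add: tight_def empty)

text \<open>The slack x(Z) - p(Z) is nonnegative, and supermodularity bounds the sum of the slacks
  of the intersection and the union by that of \<open>X\<close> and \<open>Y\<close>, which is 0.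
  This also rules out the value -\<infinity> at either set.\<close>

lemma tight_uncross:
  assumes x: "x \<in> B" and X: "tight x X" and Y: "tight x Y"
  shows "tight x (X \<inter> Y)" and "tight x (X \<union> Y)"
proof -
  have XY: "X \<subseteq> S" "Y \<subseteq> S" "p X = ereal (\<Sum>v\<in>X. x v)" "p Y = ereal (\<Sum>v\<in>Y. x v)"
    using X Y by (simp_all add: tight_def)
  then have sub: "X \<inter> Y \<subseteq> S" "X \<union> Y \<subseteq> S" by auto
  have "p X + p Y \<le> p (X \<inter> Y) + p (X \<union> Y)"
    using supermodular[unfolded supermodular_def, rule_format, of X Y] XY by simp
  moreover have "(\<Sum>v\<in>X. x v) + (\<Sum>v\<in>Y. x v) = (\<Sum>v\<in>X \<union> Y. x v) + (\<Sum>v\<in>X \<inter> Y. x v)"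
    using sum.union_inter[of X Y x] finite_sub XY by simp
  ultimately have "p (X \<inter> Y) = ereal (\<Sum>v\<in>X \<inter> Y. x v) \<and> p (X \<union> Y) = ereal (\<Sum>v\<in>X \<union> Y. x v)"
    using base_ge[OF x sub(1)] base_ge[OF x sub(2)] XY
    by (cases "p (X \<inter> Y)"; cases "p (X \<union> Y)") auto
  with sub show "tight x (X \<inter> Y)" "tight x (X \<union> Y)" by (simp_all add: tight_def)
qed

lemma tight_UN:
  assumes x: "x \<in> B" and "finite I" "\<And>i. i \<in> I \<Longrightarrow> tight x (A i)"
  shows "tight x (\<Union>i\<in>I. A i)"
  using assms(2,3) by (induction I) (auto simp: tight_empty intro: tight_uncross(2)[OF x])

lemma tight_hull:
  assumes x: "x \<in> B" and t: "t \<in> S"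
  shows "tight x (tight_hull x t)"
proof -
  have "tight x (\<Inter>F)" if "finite F" "F \<noteq> {}" "\<And>Z. Z \<in> F \<Longrightarrow> tight x Z" for F
    using that by (induction F rule: finite_ne_induct) (auto intro: tight_uncross(1)[OF x])
  moreover have "finite {Z. tight x Z \<and> t \<in> Z}"
    by (rule finite_subset[of _ "Pow S"]) (auto simp: tight_def finite_ground)
  moreover have "S \<in> {Z. tight x Z \<and> t \<in> Z}"
    using tight_ground[OF x] t by simp
  ultimately show ?thesis
    unfolding tight_hull_def by blast
qed

lemma tight_hull_self: "t \<in> tight_hull x t"
  by (auto simp: tight_hull_def)

lemma tight_hull_least: "tight x Z \<Longrightarrow> t \<in> Z \<Longrightarrow> tight_hull x t \<subseteq> Z"
  by (auto simp: tight_hull_def)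

lemma tight_hull_subset: "x \<in> B \<Longrightarrow> t \<in> S \<Longrightarrow> tight_hull x t \<subseteq> S"
  using tight_hull_least tight_ground by blast

text \<open>Only sets that contain the giver \<open>d\<close> but not the receiver \<open>u\<close>
  lose weight, so slack matters for these alone.\<close>

lemma transfer_in_base:
  assumes x: "x \<in> B" and uS: "u \<in> S" and dS: "d \<in> S" and ud: "u \<noteq> d" and a: "a \<ge> 0"
    and slack: "\<And>Z. Z \<subseteq> S \<Longrightarrow> d \<in> Z \<Longrightarrow> u \<notin> Z \<Longrightarrow> p Z \<le> ereal ((\<Sum>v\<in>Z. x v) - a)"
  shows "x(u := x u + a, d := x d - a) \<in> B"
proof -
  let ?y = "x(u := x u + a, d := x d - a)"
  have "p Z \<le> ereal (\<Sum>v\<in>Z. ?y v)" if Z: "Z \<subseteq> S" for Z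
  proof (cases "d \<in> Z \<and> u \<notin> Z")
    case True
    then show ?thesis
      unfolding sum_transfer[OF finite_sub[OF Z] ud] using slack[OF Z] by simp
  next
    case False
    have "p Z \<le> ereal (\<Sum>v\<in>Z. x v)" by (rule base_ge[OF x Z])
    also have "\<dots> \<le> ereal (\<Sum>v\<in>Z. ?y v)"
      unfolding sum_transfer[OF finite_sub[OF Z] ud] using False a by simp
    finally show ?thesis .
  qed
  moreover have "(\<Sum>v\<in>S. ?y v) = (\<Sum>v\<in>S. x v)"
    unfolding sum_transfer[OF finite_ground ud] using uS dS by simp
  moreover have "?y \<in> S \<rightarrow>\<^sub>E UNIV"
    using x uS dS by (auto simp: base_polyhedron_def PiE_def extensional_def)
  ultimately show ?thesis
    using x unfolding base_polyhedron_def by auto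
qed

lemma integral_value:
  assumes "Z \<subseteq> S" "p Z = ereal r"
  shows "r \<in> \<int>"
  using integer_valued[unfolded integer_valued_def, rule_format, OF assms(1)] assms(2) by auto

text \<open>Every tight set through \<open>d\<close> contains \<open>u\<close>, so a set that would
  lose weight has positive slack. As \<open>x\<close> and \<open>p\<close> are integral, this slack
  is at least 1.\<close>

lemma unit_transfer_integral:
  assumes x: "x \<in> integral_points S B" and dS: "d \<in> S" and u: "u \<in> tight_hull x d" and ud: "u \<noteq> d"
  shows "x(u := x u + 1, d := x d - 1) \<in> integral_points S B"
proof -
  have xB: "x \<in> B" and xI: "\<And>v. v \<in> S \<Longrightarrow> x v \<in> \<int>"
    using x by (auto simp: integral_points_def)
  have uS: "u \<in> S" using tight_hull_subset[OF xB dS] u by blast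
  have "p Z \<le> ereal ((\<Sum>v\<in>Z. x v) - 1)" if Z: "Z \<subseteq> S" "d \<in> Z" "u \<notin> Z" for Z
  proof -
    have ne: "p Z \<noteq> ereal (\<Sum>v\<in>Z. x v)"
      using tight_hull_least[of x Z d] u Z by (auto simp: tight_def)
    show ?thesis
    proof (cases "p Z")
      case (real r)
      obtain k where k: "r = real_of_int k"
        using integral_value[OF Z(1) real] by (auto elim: Ints_cases)
      have "(\<Sum>v\<in>Z. x v) \<in> \<int>" using xI Z by (intro Ints_sum) auto
      then obtain m where m: "(\<Sum>v\<in>Z. x v) = real_of_int m" by (auto elim: Ints_cases)
      show ?thesis using ne base_ge[OF xB Z(1)] real k m by simp
    qed (use base_ge[OF xB Z(1)] in auto)
  qed
  then have "x(u := x u + 1, d := x d - 1) \<in> B"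
    using xB uS dS ud by (intro transfer_in_base) auto
  then show ?thesis using xI uS dS by (auto simp: integral_points_def)
qed

section \<open>Existence of an integral point\<close>

definition fractional :: "('a \<Rightarrow> real) \<Rightarrow> 'a set" where
  "fractional x = {v \<in> S. x v \<notin> \<int>}"

lemma finite_fractional: "finite (fractional x)"
  using finite_ground by (simp add: fractional_def)

text \<open>A tight set has an integral total, which a single non-integral coordinate would
  spoil.\<close>

lemma tight_fractional_other:
  assumes "tight x Z" "d \<in> Z" "x d \<notin> \<int>"
  shows "\<exists>u\<in>Z. u \<noteq> d \<and> x u \<notin> \<int>"
proof (rule ccontr)
  assume "\<not> ?thesis"
  then have "(\<Sum>v\<in>Z - {d}. x v) \<in> \<int>" by (intro Ints_sum) auto
  moreover have Z: "Z \<subseteq> S" "p Z = ereal (\<Sum>v\<in>Z. x v)" using assms by (auto simp: tight_def)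
  then have "(\<Sum>v\<in>Z. x v) \<in> \<int>" by (rule integral_value)
  ultimately have "(\<Sum>v\<in>Z. x v) - (\<Sum>v\<in>Z - {d}. x v) \<in> \<int>" by (rule Ints_diff[rotated])
  moreover have "(\<Sum>v\<in>Z. x v) - (\<Sum>v\<in>Z - {d}. x v) = x d"
    using finite_sub[OF Z(1)] assms(2) by (simp add: sum.remove[of Z d])
  ultimately show False using assms(3) by simp
qed

text \<open>The step length is the first at which the receiving or the giving coordinate becomes
  integral or a new tight set cuts the receiving element off the hull of the giving one.\<close>

lemma fractional_descent:
  assumes x: "x \<in> B" and d: "d \<in> fractional x"
  shows "\<exists>y\<in>B. card (fractional y) < card (fractional x) \<or>
    (card (fractional y) \<le> card (fractional x) \<and> d \<in> fractional y
      \<and> card (tight_hull y d) < card (tight_hull x d))"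
proof -
  have dS: "d \<in> S" and dI: "x d \<notin> \<int>" using d by (auto simp: fractional_def)
  obtain u where u: "u \<in> tight_hull x d" "u \<noteq> d" "x u \<notin> \<int>"
    using tight_fractional_other[OF tight_hull[OF x dS] tight_hull_self dI] by blast
  have uS: "u \<in> S" using tight_hull_subset[OF x dS] u by blast
  \<comment> \<open>The sets that can block the transfer. Those with value -\<infinity> never block;
    leaving them out makes \<open>real_of_ereal (p Z)\<close> the true value.\<close>
  define C where "C = {Z. Z \<subseteq> S \<and> d \<in> Z \<and> u \<notin> Z \<and> p Z \<noteq> -\<infinity>}"
  define g where "g Z = (\<Sum>v\<in>Z. x v) - real_of_ereal (p Z)" for Z
  have C_real: "p Z = ereal (real_of_ereal (p Z))" if "Z \<in> C" for Z
    using that base_ge[OF x, of Z] by (cases "p Z") (auto simp: C_def)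
  have g_pos: "g Z > 0" if "Z \<in> C" for Z
  proof -
    have Z: "Z \<subseteq> S" "d \<in> Z" "u \<notin> Z" using that by (auto simp: C_def)
    then have "ereal (\<Sum>v\<in>Z. x v) \<noteq> p Z"
      using tight_hull_least[of x Z d] u by (auto simp: tight_def)
    then show ?thesis
      using base_ge[OF x Z(1)] C_real[OF that] unfolding g_def by (cases "p Z") auto
  qed
  define A where "A = insert (of_int \<lceil>x u\<rceil> - x u) (insert (x d - of_int \<lfloor>x d\<rfloor>) (g ` C))"
  define a where "a = Min A"
  have "finite C" unfolding C_def using finite_ground by simp
  then have A: "finite A" "A \<noteq> {}" by (auto simp: A_def)
  have "of_int \<lceil>x u\<rceil> \<noteq> x u" "of_int \<lfloor>x d\<rfloor> \<noteq> x d"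
    using u(3) dI by (metis Ints_of_int)+
  then have "of_int \<lceil>x u\<rceil> - x u > 0" "x d - of_int \<lfloor>x d\<rfloor> > 0"
    using le_of_int_ceiling[of "x u"] of_int_floor_le[of "x d"] by linarith+
  then have A_pos: "\<forall>b\<in>A. b > 0" using g_pos by (auto simp: A_def)
  have aA: "a \<in> A" unfolding a_def using A by (rule Min_in)
  have a_le: "a \<le> b" if "b \<in> A" for b unfolding a_def using A(1) that by (rule Min_le)
  have a0: "a > 0" using A_pos aA by blast
  define y where "y = x(u := x u + a, d := x d - a)"
  have yB: "y \<in> B"
    unfolding y_def
  proof (rule transfer_in_base[OF x uS dS u(2)])
    show "p Z \<le> ereal ((\<Sum>v\<in>Z. x v) - a)" if "Z \<subseteq> S" "d \<in> Z" "u \<notin> Z" for Z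
    proof (cases "p Z = -\<infinity>")
      case False
      then have Z: "Z \<in> C" using that by (simp add: C_def)
      then have "a \<le> g Z" by (intro a_le) (simp add: A_def)
      then show ?thesis using C_real[OF Z] by (cases "p Z") (auto simp: g_def)
    qed simp
  qed (use a0 in simp)
  \<comment> \<open>Only \<open>u\<close> and \<open>d\<close> change, and both were fractional
    before.\<close>
  have fsub: "fractional y \<subseteq> fractional x"
    using d uS u by (auto simp: fractional_def y_def)
  then have fle: "card (fractional y) \<le> card (fractional x)"
    by (intro card_mono finite_fractional)
  have ux: "u \<in> fractional x" using uS u by (simp add: fractional_def)
  show ?thesis
  proof (cases "u \<in> fractional y \<and> d \<in> fractional y")
    case False
    then have "fractional y \<subset> fractional x" using fsub d ux by blast
    then have "card (fractional y) < card (fractional x)"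
      by (intro psubset_card_mono finite_fractional)
    with yB show ?thesis by blast
  next
    case True
    then have yud: "x u + a \<notin> \<int>" "x d - a \<notin> \<int>" using u(2) by (auto simp: fractional_def y_def)
    have "a \<noteq> of_int \<lceil>x u\<rceil> - x u" "a \<noteq> x d - of_int \<lfloor>x d\<rfloor>"
      using yud by auto
    then obtain Z where Z: "Z \<in> C" "a = g Z" using aA by (auto simp: A_def)
    then have Z': "Z \<subseteq> S" "d \<in> Z" "u \<notin> Z" by (auto simp: C_def)
    have "(\<Sum>v\<in>Z. y v) = real_of_ereal (p Z)"
      unfolding y_def sum_transfer[OF finite_sub[OF Z'(1)] u(2)] using Z' Z(2) by (simp add: g_def)
    then have "ereal (\<Sum>v\<in>Z. y v) = p Z" using C_real[OF Z(1)] by simp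
    then have "tight y Z" using Z' by (simp add: tight_def)
    then have hZ: "tight_hull y d \<subseteq> Z" using Z' by (intro tight_hull_least)
    \<comment> \<open>The old hull contains both \<open>u\<close> and \<open>d\<close>, so its sum
      is unchanged and it stays tight. The new hull lies in it and in \<open>Z\<close>, which omits
      \<open>u\<close>; hence it is strictly smaller.\<close>
    let ?T = "tight_hull x d"
    have tT: "?T \<subseteq> S" "ereal (\<Sum>v\<in>?T. x v) = p ?T"
      using tight_hull[OF x dS] by (auto simp: tight_def)
    have "(\<Sum>v\<in>?T. y v) = (\<Sum>v\<in>?T. x v)"
      unfolding y_def sum_transfer[OF finite_sub[OF tT(1)] u(2)]
      using u(1) tight_hull_self[of d x] by simp
    then have "tight y ?T" using tT by (simp add: tight_def)
    then have "tight_hull y d \<subseteq> ?T" by (rule tight_hull_least) (rule tight_hull_self)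
    then have "tight_hull y d \<subset> ?T" using hZ Z' u(1) by blast
    then have "card (tight_hull y d) < card ?T"
      using finite_sub[OF tT(1)] by (rule psubset_card_mono[rotated])
    with yB fle True show ?thesis by blast
  qed
qed

lemma integral_points_nonempty:
  assumes "B \<noteq> {}"
  shows "integral_points S B \<noteq> {}"
proof -
  \<comment> \<open>A step that makes no coordinate integral keeps the same \<open>d\<close>
    fractional and shrinks its hull, so such steps cannot go on forever.\<close>
  have reduce: "\<exists>y\<in>B. card (fractional y) < card (fractional x)"
    if "x \<in> B" "d \<in> fractional x" for x d
    using that
  proof (induction "card (tight_hull x d)" arbitrary: x rule: less_induct)
    case less
    then show ?case
      using fractional_descent[OF less.prems] by (meson order_less_le_trans)
  qed
  obtain x where x: "x \<in> B" "\<And>y. y \<in> B \<Longrightarrow> card (fractional x) \<le> card (fractional y)"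
    using assms ex_has_least_nat[of "\<lambda>x. x \<in> B" _ "\<lambda>x. card (fractional x)"] by blast
  then have "fractional x = {}"
    using reduce[OF x(1)] by (metis equals0I not_le)
  then show ?thesis
    using x(1) by (auto simp: integral_points_def fractional_def)
qed

section \<open>The linear extension compared with inner products\<close>

lemma lovasz_sum_prefix_weights:
  fixes x :: "'a \<Rightarrow> real"
  assumes S: "S \<noteq> {}" and s: "decreasing_enumeration S \<pi> s"
  shows "(\<Sum>v\<in>S. \<pi> v * x v) = (\<Sum>v\<in>s ` {1..card S}. x v) * \<pi> (s (card S))
    + (\<Sum>j=1..<card S. (\<Sum>v\<in>s ` {1..j}. x v) * (\<pi> (s j) - \<pi> (s (j + 1))))"
proof -
  note inj = decreasing_enumerationD(1)[OF s]
  have pre: "(\<Sum>v\<in>s ` {1..j}. x v) = (\<Sum>i=1..j. x (s i))" if "j \<le> card S" for j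
    using sum.reindex[OF inj_on_subset[OF inj], of "{1..j}" x] that by simp
  have "card S \<ge> 1" using S finite_ground by (simp add: Suc_le_eq card_gt_0_iff)
  then have "(\<Sum>i=1..card S. \<pi> (s i) * x (s i)) = (\<Sum>i=1..card S. x (s i)) * \<pi> (s (card S))
    + (\<Sum>j=1..<card S. (\<Sum>i=1..j. x (s i)) * (\<pi> (s j) - \<pi> (s (j + 1))))"
    by (rule abel_summation)
  moreover have "(\<Sum>v\<in>S. \<pi> v * x v) = (\<Sum>i=1..card S. \<pi> (s i) * x (s i))"
    using sum.reindex[OF inj, of "\<lambda>v. \<pi> v * x v"] decreasing_enumerationD(2)[OF s] by simp
  moreover have "(\<Sum>j=1..<card S. (\<Sum>v\<in>s ` {1..j}. x v) * (\<pi> (s j) - \<pi> (s (j + 1))))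
    = (\<Sum>j=1..<card S. (\<Sum>i=1..j. x (s i)) * (\<pi> (s j) - \<pi> (s (j + 1))))"
    by (intro sum.cong refl) (simp add: pre del: One_nat_def)
  ultimately show ?thesis by (simp add: pre del: One_nat_def)
qed

text \<open>By \<open>lovasz_sum_prefix_weights\<close> both sides carry the same coefficients, with
  x(I_j) in place of p(I_j). The differences of successive \<open>\<pi>\<close> values are
  nonnegative, so the terms compare one by one.\<close>

lemma linear_extension_le:
  assumes S: "S \<noteq> {}" and x: "x \<in> B"
  shows "linear_extension S p \<pi> \<le> ereal (\<Sum>v\<in>S. \<pi> v * x v)"
proof -
  obtain s where s: "decreasing_enumeration S \<pi> s"
    using decreasing_enumeration_exists[OF finite_ground] by blast
  have img: "s ` {1..card S} = S" by (rule decreasing_enumerationD(2)[OF s])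
  have "(\<Sum>j=1..<card S. p (s ` {1..j}) * ereal (\<pi> (s j) - \<pi> (s (j + 1))))
    \<le> (\<Sum>j=1..<card S. ereal (\<Sum>v\<in>s ` {1..j}. x v) * ereal (\<pi> (s j) - \<pi> (s (j + 1))))"
  proof (intro sum_mono ereal_mult_right_mono)
    fix j assume j: "j \<in> {1..<card S}"
    then have "s ` {1..j} \<subseteq> S" using img by (subst img[symmetric]) (intro image_mono, auto)
    then show "p (s ` {1..j}) \<le> ereal (\<Sum>v\<in>s ` {1..j}. x v)" by (rule base_ge[OF x])
    show "0 \<le> ereal (\<pi> (s j) - \<pi> (s (j + 1)))"
      using decreasing_enumerationD(3)[OF s, of j "j + 1"] j by simp
  qed
  \<comment> \<open>The last coefficient may be negative, so equality is required here.\<close>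
  moreover have "p (s ` {1..card S}) = ereal (\<Sum>v\<in>s ` {1..card S}. x v)"
    using tight_ground[OF x] by (simp only: img tight_def)
  ultimately have "lovasz_sum S p \<pi> s \<le> ereal (\<Sum>v\<in>S. \<pi> v * x v)"
    unfolding lovasz_sum_def lovasz_sum_prefix_weights[OF S s]
    by (simp add: add_left_mono flip: plus_ereal.simps(1))
  then show ?thesis using linear_extension_eq[OF finite_ground S s] by simp
qed

text \<open>An initial segment at which \<open>\<pi>\<close> drops is an upper level set, hence
  tight. At any other segment the coefficient is 0 and both terms vanish, even where
  \<open>p\<close> is -\<infinity>.\<close>

lemma linear_extension_eq_inner:
  assumes S: "S \<noteq> {}" and x: "x \<in> B"
    and level: "\<And>r. tight x {v \<in> S. \<pi> v \<ge> r}"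
  shows "linear_extension S p \<pi> = ereal (\<Sum>v\<in>S. \<pi> v * x v)"
proof -
  obtain s where s: "decreasing_enumeration S \<pi> s"
    using decreasing_enumeration_exists[OF finite_ground] by blast
  have img: "s ` {1..card S} = S" by (rule decreasing_enumerationD(2)[OF s])
  have "(\<Sum>j=1..<card S. p (s ` {1..j}) * ereal (\<pi> (s j) - \<pi> (s (j + 1))))
    = (\<Sum>j=1..<card S. ereal (\<Sum>v\<in>s ` {1..j}. x v) * ereal (\<pi> (s j) - \<pi> (s (j + 1))))"
  proof (intro sum.cong refl)
    fix j assume j: "j \<in> {1..<card S}"
    have "\<pi> (s (j + 1)) \<le> \<pi> (s j)"
      using decreasing_enumerationD(3)[OF s, of j "j + 1"] j by simp
    then consider "\<pi> (s (j + 1)) = \<pi> (s j)" | "\<pi> (s (j + 1)) < \<pi> (s j)" by linarith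
    then show "p (s ` {1..j}) * ereal (\<pi> (s j) - \<pi> (s (j + 1)))
      = ereal (\<Sum>v\<in>s ` {1..j}. x v) * ereal (\<pi> (s j) - \<pi> (s (j + 1)))"
    proof cases
      case 1
      then show ?thesis by (simp flip: zero_ereal_def)
    next
      case 2
      then show ?thesis
        using decreasing_enumeration_segment[OF s j] level[of "\<pi> (s j)"] by (simp add: tight_def)
    qed
  qed
  moreover have "p (s ` {1..card S}) = ereal (\<Sum>v\<in>s ` {1..card S}. x v)"
    using tight_ground[OF x] by (simp only: img tight_def)
  ultimately have "lovasz_sum S p \<pi> s = ereal (\<Sum>v\<in>S. \<pi> v * x v)"
    unfolding lovasz_sum_def lovasz_sum_prefix_weights[OF S s] by simp
  then show ?thesis using linear_extension_eq[OF finite_ground S s] by simp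
qed

end

section \<open>Duality for the weighted square sum\<close>

locale weighted_square_sum = integral_supermodular +
  fixes c :: "'a \<Rightarrow> int"
  assumes nonempty: "S \<noteq> {}" and weight: "\<forall>s\<in>S. c s \<ge> 1"
begin

abbreviation "cost x \<equiv> \<Sum>s\<in>S. real_of_int (c s) * (x s)\<^sup>2"

text \<open>For \<open>s\<close> in \<open>S\<close> this is \<open>\<pi> s / (2 * c s)\<close>, the
  real maximizer of k (\<pi> s - c s k), rounded to the nearest integer with ties going up.\<close>

definition half_floor :: "('a \<Rightarrow> int) \<Rightarrow> 'a \<Rightarrow> int" where
  "half_floor \<pi> s = \<lfloor>(1/2) * (real_of_int (\<pi> s) / real_of_int (c s) + 1)\<rfloor>"

abbreviation "conj_cost \<pi> \<equiv> \<Sum>s\<in>S. real_of_int (half_floor \<pi> s)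
  * (real_of_int (\<pi> s) - real_of_int (c s) * real_of_int (half_floor \<pi> s))"

abbreviation "dual \<pi> \<equiv> linear_extension S p (\<lambda>s. real_of_int (\<pi> s)) - ereal (conj_cost \<pi>)"

lemma inner_diff_cost:
  fixes \<pi> :: "'a \<Rightarrow> int" and x :: "'a \<Rightarrow> real"
  shows "(\<Sum>s\<in>S. real_of_int (\<pi> s) * x s) - cost x
    = (\<Sum>s\<in>S. x s * (real_of_int (\<pi> s) - real_of_int (c s) * x s))"
  unfolding sum_subtractf[symmetric] by (intro sum.cong) (auto simp: algebra_simps power2_eq_square)

text \<open>The Fenchel-Young inequality: \<open>conj_cost\<close> is the conjugate of
  \<open>cost\<close> over integer vectors, and it splits into coordinates.\<close>

lemma conj_cost_ge:
  assumes "x \<in> integral_points S B"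
  shows "(\<Sum>s\<in>S. real_of_int (\<pi> s) * x s) - cost x \<le> conj_cost \<pi>"
  unfolding inner_diff_cost
proof (rule sum_mono)
  fix s assume s: "s \<in> S"
  then have "x s \<in> \<int>" using assms by (simp add: integral_points_def)
  then obtain k where k: "x s = real_of_int k" by (auto elim: Ints_cases)
  have "k * (\<pi> s - c s * k) \<le> half_floor \<pi> s * (\<pi> s - c s * half_floor \<pi> s)"
    using half_floor_bounds[of "c s" "\<pi> s"] weight s
    unfolding half_floor_def by (intro discrete_concave_quadratic_max) auto
  then have "real_of_int (k * (\<pi> s - c s * k))
      \<le> real_of_int (half_floor \<pi> s * (\<pi> s - c s * half_floor \<pi> s))"
    by (simp only: of_int_le_iff)
  then show "x s * (real_of_int (\<pi> s) - real_of_int (c s) * x s)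
    \<le> real_of_int (half_floor \<pi> s)
      * (real_of_int (\<pi> s) - real_of_int (c s) * real_of_int (half_floor \<pi> s))"
    by (simp add: k)
qed

lemma weak_duality:
  assumes x: "x \<in> integral_points S B"
  shows "dual \<pi> \<le> ereal (cost x)"
proof -
  have "x \<in> B" using x by (simp add: integral_points_def)
  then have "dual \<pi> \<le> ereal (\<Sum>s\<in>S. real_of_int (\<pi> s) * x s) - ereal (conj_cost \<pi>)"
    using linear_extension_le[OF nonempty] by (intro ereal_minus_mono) auto
  also have "\<dots> \<le> ereal (cost x)"
    using conj_cost_ge[OF x, of \<pi>] by simp
  finally show ?thesis .
qed

text \<open>There may be infinitely many integral points, but the cost takes natural number values
  on them, so a least one exists by well-ordering.\<close>

lemma minimizer_exists:
  assumes "B \<noteq> {}"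
  shows "\<exists>x\<in>integral_points S B. \<forall>y\<in>integral_points S B. cost x \<le> cost y"
proof -
  define f where "f x = nat \<lfloor>cost x\<rfloor>" for x
  have f: "real (f x) = cost x" if "x \<in> integral_points S B" for x
  proof -
    have "cost x \<in> \<int>"
      using that by (intro Ints_sum) (auto simp: integral_points_def)
    moreover have "cost x \<ge> 0"
      using weight by (intro sum_nonneg mult_nonneg_nonneg) force+
    ultimately show ?thesis by (auto simp: f_def elim!: Ints_cases)
  qed
  obtain x where "x \<in> integral_points S B" "\<And>y. y \<in> integral_points S B \<Longrightarrow> f x \<le> f y"
    using integral_points_nonempty[OF assms]
      ex_has_least_nat[of "\<lambda>x. x \<in> integral_points S B" _ f] by blast
  then show ?thesis by (intro bexI[of _ x]) (auto simp flip: f)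
qed

text \<open>Moving a unit from \<open>t\<close> to \<open>s\<close> changes the cost by the right
  side minus the left side, which minimality makes nonnegative. For \<open>s = t\<close> there is no
  move, and \<open>c t \<ge> 1\<close> suffices.\<close>

lemma minimizer_marginals:
  fixes x :: "'a \<Rightarrow> int"
  assumes x: "x' \<in> integral_points S B" "\<And>s. s \<in> S \<Longrightarrow> x' s = real_of_int (x s)"
    and min: "\<forall>y\<in>integral_points S B. cost x' \<le> cost y"
    and t: "t \<in> S" and s: "s \<in> tight_hull x' t"
  shows "c t * (2 * x t - 1) \<le> c s * (2 * x s + 1)"
proof (cases "s = t")
  case True
  then show ?thesis using weight t by (auto intro!: mult_left_mono)
next
  case False
  have sS: "s \<in> S" using tight_hull_subset[of x' t] x(1) t s by (auto simp: integral_points_def)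
  let ?y = "x'(s := x' s + 1, t := x' t - 1)"
  have split: "cost z = c s * (z s)\<^sup>2 + (c t * (z t)\<^sup>2 + (\<Sum>v\<in>S - {s} - {t}. c v * (z v)\<^sup>2))"
    for z :: "'a \<Rightarrow> real"
    using finite_ground sS t False by (simp add: sum.remove[of S s] sum.remove[of "S - {s}" t])
  have "(\<Sum>v\<in>S - {s} - {t}. c v * (?y v)\<^sup>2) = (\<Sum>v\<in>S - {s} - {t}. c v * (x' v)\<^sup>2)"
    by (intro sum.cong) auto
  then have "cost ?y = c s * (x' s + 1)\<^sup>2
      + (c t * (x' t - 1)\<^sup>2 + (\<Sum>v\<in>S - {s} - {t}. c v * (x' v)\<^sup>2))"
    using False by (subst split) simp
  moreover have "cost x' \<le> cost ?y"
    using unit_transfer_integral[OF x(1) t s False] min by blast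
  moreover note split[of x']
  ultimately have "real_of_int (c s) * (x' s)\<^sup>2 + c t * (x' t)\<^sup>2
      \<le> c s * (x' s + 1)\<^sup>2 + c t * (x' t - 1)\<^sup>2"
    by linarith
  then have "real_of_int (c t * (2 * x t - 1)) \<le> real_of_int (c s * (2 * x s + 1))"
    using x(2)[OF t] x(2)[OF sS] by (simp add: power2_eq_square algebra_simps)
  then show ?thesis by (simp only: of_int_le_iff)
qed

lemma strong_duality:
  assumes x: "x \<in> integral_points S B" and min: "\<forall>y\<in>integral_points S B. cost x \<le> cost y"
  shows "\<exists>\<pi>\<in>S \<rightarrow>\<^sub>E (UNIV :: int set). dual \<pi> = ereal (cost x)"
proof -
  have xB: "x \<in> B" using x by (simp add: integral_points_def)
  define k where "k s = \<lfloor>x s\<rfloor>" for s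
  have xk: "x s = real_of_int (k s)" if "s \<in> S" for s
    using x that by (auto simp: integral_points_def k_def elim: Ints_cases)
  \<comment> \<open>The choice \<open>t = s\<close> makes \<open>M s\<close> nonempty and gives the
    lower bound on \<open>\<pi> s\<close>; \<open>minimizer_marginals\<close> bounds every member
    from above.\<close>
  define M where "M s = (\<lambda>t. c t * (2 * k t - 1)) ` {t \<in> S. s \<in> tight_hull x t}" for s
  define \<pi> where "\<pi> = (\<lambda>s\<in>S. Max (M s))"
  have M: "finite (M s)" for s using finite_ground by (simp add: M_def)
  have M_self: "c s * (2 * k s - 1) \<in> M s" if "s \<in> S" for s
    using that tight_hull_self[of s x] by (auto simp: M_def)
  have lower: "c s * (2 * k s - 1) \<le> \<pi> s" if "s \<in> S" for s
    using that M M_self by (simp add: \<pi>_def)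
  have upper: "\<pi> s \<le> c s * (2 * k s + 1)" if "s \<in> S" for s
  proof -
    have "\<pi> s \<in> M s"
      using that M_self[OF that] Max_in[OF M[of s]] by (auto simp: \<pi>_def)
    then show ?thesis
      using minimizer_marginals[OF x xk min] by (auto simp: M_def)
  qed
  have "tight x {v \<in> S. real_of_int (\<pi> v) \<ge> r}" for r
  proof -
    let ?I = "{t \<in> S. real_of_int (c t * (2 * k t - 1)) \<ge> r}"
    \<comment> \<open>A maximum reaches \<open>r\<close> exactly when some member does. For large
      \<open>r\<close> the union is empty, which \<open>tight_UN\<close> allows.\<close>
    have "{v \<in> S. real_of_int (\<pi> v) \<ge> r} = (\<Union>t\<in>?I. tight_hull x t)"
    proof (intro equalityI subsetI)
      fix v assume v: "v \<in> {v \<in> S. real_of_int (\<pi> v) \<ge> r}"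
      then have "\<pi> v \<in> M v"
        using M_self[of v] Max_in[OF M[of v]] by (auto simp: \<pi>_def)
      then show "v \<in> (\<Union>t\<in>?I. tight_hull x t)" using v by (auto simp: M_def)
    next
      fix v assume "v \<in> (\<Union>t\<in>?I. tight_hull x t)"
      then obtain t where t: "t \<in> ?I" "v \<in> tight_hull x t" by blast
      then have vS: "v \<in> S" using tight_hull_subset[OF xB] by blast
      have "c t * (2 * k t - 1) \<in> M v" using t by (auto simp: M_def)
      then have "c t * (2 * k t - 1) \<le> \<pi> v" using M vS by (simp add: \<pi>_def)
      then have "real_of_int (c t * (2 * k t - 1)) \<le> real_of_int (\<pi> v)" by (simp only: of_int_le_iff)
      with t vS show "v \<in> {v \<in> S. real_of_int (\<pi> v) \<ge> r}" by simp
    qed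
    moreover have "tight x (\<Union>t\<in>?I. tight_hull x t)"
      using finite_ground tight_hull[OF xB] by (intro tight_UN[OF xB]) auto
    ultimately show ?thesis by simp
  qed
  then have ext: "linear_extension S p (\<lambda>s. real_of_int (\<pi> s)) = ereal (\<Sum>s\<in>S. real_of_int (\<pi> s) * x s)"
    by (rule linear_extension_eq_inner[OF nonempty xB])
  \<comment> \<open>The converse of \<open>conj_cost_ge\<close>: by the two bounds on
    \<open>\<pi> s\<close>, the integer \<open>k s\<close> is itself a maximizer in its
    coordinate.\<close>
  have "conj_cost \<pi> \<le> (\<Sum>s\<in>S. real_of_int (\<pi> s) * x s) - cost x"
    unfolding inner_diff_cost
  proof (rule sum_mono)
    fix s assume s: "s \<in> S"
    have "half_floor \<pi> s * (\<pi> s - c s * half_floor \<pi> s) \<le> k s * (\<pi> s - c s * k s)"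
      using weight s lower[OF s] upper[OF s] by (intro discrete_concave_quadratic_max) auto
    then have "real_of_int (half_floor \<pi> s * (\<pi> s - c s * half_floor \<pi> s))
        \<le> real_of_int (k s * (\<pi> s - c s * k s))"
      by (simp only: of_int_le_iff)
    then show "real_of_int (half_floor \<pi> s)
        * (real_of_int (\<pi> s) - real_of_int (c s) * real_of_int (half_floor \<pi> s))
      \<le> x s * (real_of_int (\<pi> s) - real_of_int (c s) * x s)"
      by (simp add: xk[OF s])
  qed
  with conj_cost_ge[OF x, of \<pi>]
  have "conj_cost \<pi> = (\<Sum>s\<in>S. real_of_int (\<pi> s) * x s) - cost x" by linarith
  then have "dual \<pi> = ereal (cost x)" by (simp add: ext)
  moreover have "\<pi> \<in> S \<rightarrow>\<^sub>E UNIV" by (simp add: \<pi>_def)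
  ultimately show ?thesis by blast
qed

text \<open>A minimizer and its \<open>\<pi>\<close> from \<open>strong_duality\<close> have equal
  values, which gives one inequality; \<open>weak_duality\<close> for all pairs gives the
  other.\<close>

lemma min_eq_max:
  assumes "B \<noteq> {}"
  shows "(INF x\<in>integral_points S B. ereal (cost x)) = (SUP \<pi>\<in>S \<rightarrow>\<^sub>E UNIV. dual \<pi>)"
proof (rule antisym)
  obtain x where x: "x \<in> integral_points S B" "\<forall>y\<in>integral_points S B. cost x \<le> cost y"
    using minimizer_exists[OF assms] by blast
  obtain \<pi> where \<pi>: "\<pi> \<in> S \<rightarrow>\<^sub>E (UNIV :: int set)" "dual \<pi> = ereal (cost x)"
    using strong_duality[OF x] by blast
  have "(INF x\<in>integral_points S B. ereal (cost x)) \<le> dual \<pi>"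
    unfolding \<pi>(2) using x(1) by (rule INF_lower)
  also have "\<dots> \<le> (SUP \<pi>\<in>S \<rightarrow>\<^sub>E UNIV. dual \<pi>)" using \<pi>(1) by (rule SUP_upper)
  finally show "(INF x\<in>integral_points S B. ereal (cost x)) \<le> (SUP \<pi>\<in>S \<rightarrow>\<^sub>E UNIV. dual \<pi>)" .
  show "(SUP \<pi>\<in>S \<rightarrow>\<^sub>E UNIV. dual \<pi>) \<le> (INF x\<in>integral_points S B. ereal (cost x))"
    by (intro SUP_least INF_greatest weak_duality)
qed

end

theorem theorem7p3:
  fixes S :: "'a set" and p :: "'a set \<Rightarrow> ereal" and c :: "'a \<Rightarrow> int"
  assumes "finite S" and "S \<noteq> {}"
    and "integer_valued S p" and "supermodular S p"
    and "p {} = 0" and "\<bar>p S\<bar> \<noteq> \<infinity>"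
    and "base_polyhedron S p \<noteq> {}"
    and "\<forall>s\<in>S. c s \<ge> 1"
  shows "(\<exists>x\<in>integral_points S (base_polyhedron S p).
            \<forall>y\<in>integral_points S (base_polyhedron S p).
              (\<Sum>s\<in>S. real_of_int (c s) * (x s)\<^sup>2) \<le> (\<Sum>s\<in>S. real_of_int (c s) * (y s)\<^sup>2))
    \<and> (INF x\<in>integral_points S (base_polyhedron S p). ereal (\<Sum>s\<in>S. real_of_int (c s) * (x s)\<^sup>2))
      = (SUP \<pi>\<in>(S \<rightarrow>\<^sub>E (UNIV :: int set)).
           linear_extension S p (\<lambda>s. real_of_int (\<pi> s))
           - ereal (\<Sum>s\<in>S.
               real_of_int \<lfloor>(1/2) * (real_of_int (\<pi> s) / real_of_int (c s) + 1)\<rfloor>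
               * (real_of_int (\<pi> s)
                  - real_of_int (c s)
                    * real_of_int \<lfloor>(1/2) * (real_of_int (\<pi> s) / real_of_int (c s) + 1)\<rfloor>)))"
proof -
  interpret weighted_square_sum S p c
    using assms by unfold_locales
  show ?thesis
    using minimizer_exists[OF assms(7)] min_eq_max[OF assms(7)]
    unfolding half_floor_def by (rule conjI)
qed

end
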